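(* Let $\{a_n\}_{n\ge1}$ be a sequence of nonzero complex numbers, and let $f(z)$ be an entire function with zeros at $\{a_n\}$ listed according to their multiplicities. Suppose $f$ has a zero of order $k\ge0$ at the origin. If $X$ is a graphical isotropic minimal surface with height function $h(x,y)=\operatorname{Im}(\ln f(z))$, $z=x+iy$, then $h$ admits a decomposition on a simply connected domain excluding $\{a_n\}_{n\ge1}$ and $0$ into the following components: (1) a finite sum representing $k$ helicoids, given by $k\tan^{-1}(y/x)$; (2) an infinite sum of dilated and translated helicoids, where each term is given by $$\tan^{-1}\!\left(\frac{a_n^2x-a_n^1y}{|a_n|^2-a_n^1x-a_n^2y}\right)$$ associated with the nonzero zeros $a_n=a_n^1+ia_n^2$ of $f$; (3) an infinite sum of graphical isotropic minimal surfaces given by the harmonic polynomials $\operatorname{Im}(P_n(z/a_n))$, derived from the Weierstrass primary factors in the product formula for $f$; (4) a graphical isotropic minimal surface given by the harmonic function $\operatorname{Im}(g(z))$, where $g$ is the entire function appearing in the Weierstrass product formula for $f$. Furthermore, as the Weierstrass product representation of an entire function is not unique, the corresponding decomposition of the isotropic minimal surface is likewise not uniquely determined.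
   Context: Isotropic $3$-space $\mathbb I^3$ is $\mathbb R^3$ with the degenerate metric $dx^2+dy^2$; a graph $(x,y,h(x,y))$ is an isotropic minimal surface if and only if $\Delta h=0$. The (isotropic) helicoid is the graph of $\tan^{-1}(y/x)$. In $a_n=a_n^1+ia_n^2$, the superscripts are indices: $a_n^1,a_n^2\in\mathbb R$ are the real and imaginary parts of $a_n$; the $n$-th term in (2) is $\tan^{-1}(V/U)$ where $1-z/a_n=U+iV$. The Weierstrass product formula for $f$ is $f(z)=z^ke^{g(z)}\prod_{n=1}^\infty E_n(z/a_n)$, where $g$ is entire and $E_n(w)=(1-w)e^{P_n(w)}$ is the Weierstrass primary factor, with $P_n(w)=w+\frac{w^2}2+\dots+\frac{w^n}n$.
   Formalization: The infinite sums (2) and (3) are summed jointly, term by term, since separately they may diverge (e.g. a_n = n: terms behave like -y/n and y/n); each inverse tangent is read as a continuous branch on the domain. *)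

theory Defs
  imports "HOL-Complex_Analysis.Complex_Analysis"
begin

text \<open>
  The base plane of isotropic 3-space, with coordinates (x, y), is identified with the complex
  plane through z = Complex x y.  Domains are sets of complex numbers, height functions are
  functions of the two real coordinates.
\<close>

definition height_graph :: "complex set \<Rightarrow> (real \<Rightarrow> real \<Rightarrow> real) \<Rightarrow> (real \<times> real \<times> real) set" where
  "height_graph D h = {(x, y, h x y) |x y. Complex x y \<in> D}"

text \<open>Twice continuous differentiability: all second order partial derivatives exist and are
  continuous (continuity of h and of its first order partial derivatives is a consequence).\<close>

definition C2_on :: "complex set \<Rightarrow> (real \<Rightarrow> real \<Rightarrow> real) \<Rightarrow> bool" where
  "C2_on D h \<longleftrightarrow> open D \<and> (\<exists>hx hy hxx hxy hyx hyy.
     (\<forall>x y. Complex x y \<in> D \<longrightarrow>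
        ((\<lambda>s. h s y) has_real_derivative hx x y) (at x) \<and>
        ((\<lambda>s. h x s) has_real_derivative hy x y) (at y) \<and>
        ((\<lambda>s. hx s y) has_real_derivative hxx x y) (at x) \<and>
        ((\<lambda>s. hx x s) has_real_derivative hxy x y) (at y) \<and>
        ((\<lambda>s. hy s y) has_real_derivative hyx x y) (at x) \<and>
        ((\<lambda>s. hy x s) has_real_derivative hyy x y) (at y)) \<and>
     (\<forall>u \<in> {hxx, hxy, hyx, hyy}. continuous_on D (\<lambda>z. u (Re z) (Im z))))"

definition laplacian :: "(real \<Rightarrow> real \<Rightarrow> real) \<Rightarrow> real \<Rightarrow> real \<Rightarrow> real" where
  "laplacian h x y = deriv (\<lambda>s. deriv (\<lambda>r. h r y) s) x + deriv (\<lambda>s. deriv (\<lambda>r. h x r) s) y"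

text \<open>With respect to the degenerate metric dx^2 + dy^2, the graph of h is minimal iff the
  (Euclidean, planar) Laplacian of h vanishes.\<close>

definition graphical_isotropic_minimal_surface ::
    "(real \<times> real \<times> real) set \<Rightarrow> complex set \<Rightarrow> (real \<Rightarrow> real \<Rightarrow> real) \<Rightarrow> bool" where
  "graphical_isotropic_minimal_surface X D h \<longleftrightarrow>
     X = height_graph D h \<and> C2_on D h \<and> (\<forall>x y. Complex x y \<in> D \<longrightarrow> laplacian h x y = 0)"

text \<open>The full (multivalued) graph of arctan (y / x), completed by the axis.\<close>

definition helicoid :: "(real \<times> real \<times> real) set" where
  "helicoid = {(x, y, t). x * sin t = y * cos t}"

text \<open>Dilation of the base plane by r followed by translation by v.\<close>

definition dilate_translate ::
    "real \<Rightarrow> real \<times> real \<times> real \<Rightarrow> real \<times> real \<times> real \<Rightarrow> real \<times> real \<times> real" where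
  "dilate_translate r v = (\<lambda>(x, y, t). (r * x, r * y, t) + v)"

text \<open>The inverse tangent of V / U is defined up to integer multiples of pi; on a
  domain meeting the zero set of U it is read as a continuous branch on the whole domain.\<close>

definition arctan_branch ::
    "complex set \<Rightarrow> (real \<Rightarrow> real \<Rightarrow> real) \<Rightarrow> (real \<Rightarrow> real \<Rightarrow> real) \<Rightarrow> (real \<Rightarrow> real \<Rightarrow> real) \<Rightarrow> bool" where
  "arctan_branch D V U t \<longleftrightarrow>
     continuous_on D (\<lambda>z. t (Re z) (Im z)) \<and>
     (\<forall>x y. Complex x y \<in> D \<and> U x y \<noteq> 0 \<longrightarrow>
        (\<exists>m::int. t x y = arctan (V x y / U x y) + of_int m * pi))"

definition log_branch :: "complex set \<Rightarrow> (complex \<Rightarrow> complex) \<Rightarrow> (complex \<Rightarrow> complex) \<Rightarrow> bool" where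
  "log_branch D f L \<longleftrightarrow> continuous_on D L \<and> (\<forall>z\<in>D. exp (L z) = f z)"

text \<open>Sequences are indexed by the positive integers; their value at 0 is irrelevant.\<close>

definition lists_nonzero_zeros :: "(nat \<Rightarrow> complex) \<Rightarrow> (complex \<Rightarrow> complex) \<Rightarrow> bool" where
  "lists_nonzero_zeros a f \<longleftrightarrow>
     (\<forall>z. z \<noteq> 0 \<longrightarrow> finite {n. n \<ge> 1 \<and> a n = z} \<and> zorder f z = int (card {n. n \<ge> 1 \<and> a n = z}))"

text \<open>The polynomial in the exponent of the library's weierstrass-factor constant.\<close>

definition primary_exponent :: "nat \<Rightarrow> complex \<Rightarrow> complex" where
  "primary_exponent n w = (\<Sum>j=1..n. w ^ j / of_nat j)"

text \<open>
  The factorisation f(z) = z^k * exp (g z) * (\<Prod>n\<ge>1. E_{p n} (z / a n)).  The standard choice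
  of degrees is p n = n; other choices give other Weierstrass products of the same function.
\<close>

definition weierstrass_representation ::
    "(complex \<Rightarrow> complex) \<Rightarrow> nat \<Rightarrow> (nat \<Rightarrow> complex) \<Rightarrow> (nat \<Rightarrow> nat) \<Rightarrow> (complex \<Rightarrow> complex) \<Rightarrow> bool" where
  "weierstrass_representation f k a p g \<longleftrightarrow>
     g holomorphic_on UNIV \<and>
     (\<forall>z. convergent_prod (\<lambda>n. weierstrass_factor (p (Suc n)) (z / a (Suc n))) \<and>
          f z = z ^ k * exp (g z) * (\<Prod>n. weierstrass_factor (p (Suc n)) (z / a (Suc n))))"

text \<open>
  The decomposition of the height function h induced by the data (k, a, p, g).  The series of the
  helicoids and the series of the harmonic polynomials need not converge separately
  (take a n = n, p n = n), so they are summed jointly, term by term; S is the sum, and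
  convergence is uniform on compact subsets of the domain.
\<close>

definition helicoid_decomposition ::
    "complex set \<Rightarrow> (real \<Rightarrow> real \<Rightarrow> real) \<Rightarrow> nat \<Rightarrow> (nat \<Rightarrow> complex) \<Rightarrow> (nat \<Rightarrow> nat)
      \<Rightarrow> (complex \<Rightarrow> complex) \<Rightarrow> bool" where
  "helicoid_decomposition D h k a p g \<longleftrightarrow> (\<exists>t0 t S.
     arctan_branch D (\<lambda>x y. y) (\<lambda>x y. x) t0 \<and>
     height_graph D t0 \<subseteq> helicoid \<and>
     (\<forall>n\<ge>1.
        arctan_branch D
          (\<lambda>x y. Im (a n) * x - Re (a n) * y)
          (\<lambda>x y. (cmod (a n))\<^sup>2 - Re (a n) * x - Im (a n) * y) (t n) \<and>
        (\<exists>r>0. \<exists>v. height_graph D (t n) \<subseteq> dilate_translate r v ` helicoid) \<and>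
        (let q = (\<lambda>x y. Im (primary_exponent (p n) (Complex x y / a n)))
         in graphical_isotropic_minimal_surface (height_graph UNIV q) UNIV q)) \<and>
     (let u = (\<lambda>x y. Im (g (Complex x y)))
      in graphical_isotropic_minimal_surface (height_graph UNIV u) UNIV u) \<and>
     (\<forall>K. compact K \<and> K \<subseteq> D \<longrightarrow>
        uniform_limit K
          (\<lambda>N z. \<Sum>n=1..N. t n (Re z) (Im z) + Im (primary_exponent (p n) (z / a n)))
          S sequentially) \<and>
     (\<forall>x y. Complex x y \<in> D \<longrightarrow>
        h x y = real k * t0 x y + S (Complex x y) + Im (g (Complex x y))))"

end

theory Submission
  imports Defs
begin

text \<open>
  On the simply connected domain every factor of the Weierstrass product has a holomorphic
  logarithm.  Normalised at a base point by the principal branch, these logarithms sum locally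
  uniformly, and the resulting logarithm of \<open>f\<close> differs from the given one by a constant multiple
  of \<open>2 * pi * \<i>\<close>.  The imaginary part of a logarithm of \<open>1 - z / a n\<close> is a
  translated helicoid.  Non-uniqueness comes from replacing \<open>E\<^sub>1\<close> by \<open>E\<^sub>2\<close> in the first factor,
  which subtracts \<open>(z / a 1)\<^sup>2 / 2\<close> from \<open>g\<close>.
\<close>

section \<open>Primary factors and imaginary parts of entire functions\<close>

lemma weierstrass_factor_primary_exponent:
  "weierstrass_factor n w = (1 - w) * exp (primary_exponent n w)"
  by (simp add: weierstrass_factor_def primary_exponent_def)

lemma primary_exponent_holomorphic [holomorphic_intros]:
  "u holomorphic_on A \<Longrightarrow> (\<lambda>z. primary_exponent n (u z)) holomorphic_on A"
  unfolding primary_exponent_def by (intro holomorphic_intros) auto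

text \<open>The Cauchy-Riemann equations in real form: \<open>Complex s y\<close> moves with
  velocity 1 and \<open>Complex x s\<close> with velocity i, so the partial derivatives of
  \<open>g\<close> are g' and i g', and the four formulas are their real and imaginary
  parts.\<close>

lemma
  assumes "g holomorphic_on UNIV"
  shows has_real_derivative_Im_x:
      "((\<lambda>s. Im (g (Complex s y))) has_real_derivative Im (deriv g (Complex x y))) (at x)"
    and has_real_derivative_Im_y:
      "((\<lambda>s. Im (g (Complex x s))) has_real_derivative Re (deriv g (Complex x y))) (at y)"
    and has_real_derivative_Re_x:
      "((\<lambda>s. Re (g (Complex s y))) has_real_derivative Re (deriv g (Complex x y))) (at x)"
    and has_real_derivative_Re_y:
      "((\<lambda>s. Re (g (Complex x s))) has_real_derivative - Im (deriv g (Complex x y))) (at y)"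
proof -
  have g: "(g has_field_derivative deriv g (Complex x y)) (at (Complex x y))"
    using assms by (intro holomorphic_derivI[of _ UNIV]) auto
  have "((\<lambda>s. of_real s + of_real y * \<i>) has_vector_derivative 1) (at x)"
    by (auto intro!: derivative_eq_intros)
  then have 1: "((\<lambda>s. Complex s y) has_vector_derivative 1) (at x)"
    by (simp add: Complex_eq mult.commute)
  have "((\<lambda>s. of_real x + of_real s * \<i>) has_vector_derivative \<i>) (at y)"
    by (auto intro!: derivative_eq_intros)
  then have 2: "((\<lambda>s. Complex x s) has_vector_derivative \<i>) (at y)"
    by (simp add: Complex_eq mult.commute)
  have gx: "((\<lambda>s. g (Complex s y)) has_vector_derivative deriv g (Complex x y)) (at x)"
    using field_vector_diff_chain_at[OF 1 g] by (simp add: o_def)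
  have gy: "((\<lambda>s. g (Complex x s)) has_vector_derivative \<i> * deriv g (Complex x y)) (at y)"
    using field_vector_diff_chain_at[OF 2 g] by (simp add: o_def)
  show "((\<lambda>s. Im (g (Complex s y))) has_real_derivative Im (deriv g (Complex x y))) (at x)"
    "((\<lambda>s. Im (g (Complex x s))) has_real_derivative Re (deriv g (Complex x y))) (at y)"
    "((\<lambda>s. Re (g (Complex s y))) has_real_derivative Re (deriv g (Complex x y))) (at x)"
    "((\<lambda>s. Re (g (Complex x s))) has_real_derivative - Im (deriv g (Complex x y))) (at y)"
    using bounded_linear.has_vector_derivative[OF bounded_linear_Im gx]
      bounded_linear.has_vector_derivative[OF bounded_linear_Im gy]
      bounded_linear.has_vector_derivative[OF bounded_linear_Re gx]
      bounded_linear.has_vector_derivative[OF bounded_linear_Re gy]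
    by (simp_all add: has_real_derivative_iff_has_vector_derivative)
qed

text \<open>Serves both harmonic components of the decomposition, the primary polynomials and
  \<open>Im (g z)\<close>. The two pure second partials are opposite, so they cancel in the
  Laplacian.\<close>

lemma minimal_surface_Im_entire:
  assumes g: "g holomorphic_on UNIV"
  defines "u \<equiv> (\<lambda>x y. Im (g (Complex x y)))"
  shows "graphical_isotropic_minimal_surface (height_graph UNIV u) UNIV u"
proof -
  have g': "deriv g holomorphic_on UNIV"
    by (rule holomorphic_deriv[OF g open_UNIV])
  have "deriv (deriv g) holomorphic_on UNIV"
    by (rule holomorphic_deriv[OF g' open_UNIV])
  then have "continuous_on UNIV (deriv (deriv g))"
    by (rule holomorphic_on_imp_continuous_on)
  then have cont: "continuous_on UNIV (\<lambda>z. Im (deriv (deriv g) z))"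
    "continuous_on UNIV (\<lambda>z. Re (deriv (deriv g) z))"
    "continuous_on UNIV (\<lambda>z. - Im (deriv (deriv g) z))"
    by (intro continuous_on_Im continuous_on_Re continuous_on_minus; simp)+
  note dg = has_real_derivative_Im_x[OF g] has_real_derivative_Im_y[OF g]
  note dg' = has_real_derivative_Im_x[OF g'] has_real_derivative_Im_y[OF g']
    has_real_derivative_Re_x[OF g'] has_real_derivative_Re_y[OF g']
  \<comment> \<open>The partials are u_x = Im g', u_y = Re g', u_xx = Im g'', u_xy = u_yx = Re g'',
    u_yy = - Im g''; the one witness Re g'' serves both mixed partials.\<close>
  have "C2_on UNIV u"
    unfolding C2_on_def u_def
    by (intro conjI open_UNIV exI[of _ "\<lambda>x y. Im (deriv g (Complex x y))"]
        exI[of _ "\<lambda>x y. Re (deriv g (Complex x y))"]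
        exI[of _ "\<lambda>x y. Im (deriv (deriv g) (Complex x y))"]
        exI[of _ "\<lambda>x y. Re (deriv (deriv g) (Complex x y))"]
        exI[of _ "\<lambda>x y. - Im (deriv (deriv g) (Complex x y))"])
      (simp_all add: dg dg' cont)
  moreover have "laplacian u x y = 0" for x y
  proof -
    have "deriv (\<lambda>r. u r y) = (\<lambda>s. Im (deriv g (Complex s y)))"
      "deriv (\<lambda>r. u x r) = (\<lambda>s. Re (deriv g (Complex x s)))"
      unfolding u_def by (intro ext DERIV_imp_deriv dg)+
    then show ?thesis
      by (simp add: laplacian_def DERIV_imp_deriv[OF dg'(1)] DERIV_imp_deriv[OF dg'(4)])
  qed
  ultimately show ?thesis
    by (simp add: graphical_isotropic_minimal_surface_def)
qed

text \<open>The partial derivatives of Im g are Im g' and Re g', and both vanish where Im g is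
  locally constant. This later shows that two decompositions really differ.\<close>

lemma Im_constant_on_imp_deriv_eq_0:
  assumes g: "g holomorphic_on UNIV" and D: "open D" "z \<in> D"
    and const: "(\<lambda>z. Im (g z)) constant_on D"
  shows "deriv g z = 0"
proof -
  obtain c where c: "\<And>w. w \<in> D \<Longrightarrow> Im (g w) = c"
    using const by (auto simp: constant_on_def)
  obtain d where d: "d > 0" "ball z d \<subseteq> D"
    using D openE by blast
  obtain x y where z: "z = Complex x y"
    by (cases z)
  have "Complex x s \<in> D" if "\<bar>y - s\<bar> < d" for s
    using d that by (intro subsetD[OF d(2)]) (auto simp: z dist_norm cmod_def)
  then have 1: "Re (deriv g z) = 0"
    unfolding z using DERIV_local_const[OF has_real_derivative_Im_y[OF g, of x y] d(1)] c D(2) z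
    by simp
  have "Complex s y \<in> D" if "\<bar>x - s\<bar> < d" for s
    using d that by (intro subsetD[OF d(2)]) (auto simp: z dist_norm cmod_def)
  then have "Im (deriv g z) = 0"
    unfolding z using DERIV_local_const[OF has_real_derivative_Im_x[OF g, of y x] d(1)] c D(2) z
    by simp
  with 1 show ?thesis
    by (simp add: complex_eq_iff)
qed

section \<open>Inverse tangents and helicoids from logarithms\<close>

text \<open>The imaginary part of a logarithm is an argument, which a positive factor
  \<open>c\<close> leaves alone; \<open>c\<close> is there to clear denominators. A shift by a
  multiple of pi is invisible to the tangent.\<close>

lemma arctan_branch_Im_log:
  assumes L: "log_branch D f L" and "c > 0"
    and f: "\<And>x y. Complex x y \<in> D \<Longrightarrow> of_real c * f (Complex x y) = Complex (U x y) (V x y)"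
  shows "arctan_branch D V U (\<lambda>x y. Im (L (Complex x y)) + of_int m * pi)"
  unfolding arctan_branch_def
proof (intro conjI allI impI)
  show "continuous_on D (\<lambda>z. Im (L (Complex (Re z) (Im z))) + of_int m * pi)"
    using L by (auto simp: log_branch_def intro!: continuous_intros)
  fix x y assume xy: "Complex x y \<in> D \<and> U x y \<noteq> 0"
  define t where "t = Im (L (Complex x y))"
  define r where "r = c * exp (Re (L (Complex x y)))"
  have "Complex (U x y) (V x y) = of_real c * exp (L (Complex x y))"
    using xy L f by (simp add: log_branch_def)
  then have U: "U x y = r * cos t" and V: "V x y = r * sin t"
    by (auto simp: complex_eq_iff Re_exp Im_exp r_def t_def)
  define s where "s = arctan (V x y / U x y)"
  have "cos s \<noteq> 0" "tan s = sin t / cos t"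
    using xy by (auto simp: s_def U V tan_arctan)
  \<comment> \<open>\<open>s\<close> and \<open>t\<close> have the same tangent. The quotient of
    \<open>V\<close> by \<open>U\<close> forgets the sign of \<open>U\<close>, so they agree modulo
    pi rather than 2 pi.\<close>
  then have "sin (t - s) = 0"
    using xy by (auto simp: sin_diff tan_def U field_simps)
  then obtain i :: int where "t - s = of_int i * pi"
    by (auto simp: sin_zero_iff_int2)
  then have "t + of_int m * pi = s + of_int (i + m) * pi"
    by (simp add: algebra_simps)
  then show "\<exists>n::int. Im (L (Complex x y)) + of_int m * pi =
      arctan (V x y / U x y) + of_int n * pi"
    unfolding t_def s_def by blast
qed

text \<open>Adding \<open>Ln c\<close> turns \<open>L\<close> into a logarithm of
  \<open>z - b\<close>, whose imaginary part traces a helicoid with axis over \<open>b\<close>.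
  Undoing this costs a horizontal translation by \<open>b\<close> and a vertical one by
  \<open>- Im (Ln c)\<close>, with dilation factor 1.\<close>

lemma height_graph_log_subset_helicoid:
  assumes "log_branch D (\<lambda>z. (z - b) / c) L" and "c \<noteq> 0"
  shows "\<exists>r>0. \<exists>v. height_graph D (\<lambda>x y. Im (L (Complex x y)) + of_int m * pi)
           \<subseteq> dilate_translate r v ` helicoid"
proof (intro exI conjI subsetI)
  fix P assume "P \<in> height_graph D (\<lambda>x y. Im (L (Complex x y)) + of_int m * pi)"
  then obtain x y where D: "Complex x y \<in> D"
    and P: "P = (x, y, Im (L (Complex x y)) + of_int m * pi)"
    by (auto simp: height_graph_def)
  define w where "w = L (Complex x y) + Ln c"
  have "exp w = Complex x y - b"
    using assms D by (simp add: w_def log_branch_def exp_add)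
  then have xy: "x - Re b = exp (Re w) * cos (Im w)" "y - Im b = exp (Re w) * sin (Im w)"
    by (auto simp: complex_eq_iff Re_exp Im_exp)
  \<comment> \<open>A shift by \<open>m * pi\<close> multiplies sine and cosine by the same sign,
    which preserves the equation of the helicoid.\<close>
  have "(x - Re b) * sin (Im w + of_int m * pi) = (y - Im b) * cos (Im w + of_int m * pi)"
    unfolding xy sin_add cos_add by (simp add: mult.commute[of "of_int m"])
  then show "P \<in> dilate_translate 1 (Re b, Im b, - Im (Ln c)) ` helicoid"
    by (intro image_eqI[of _ _ "(x - Re b, y - Im b, Im w + of_int m * pi)"])
      (auto simp: P helicoid_def dilate_translate_def w_def)
qed auto

section \<open>Branches of logarithms\<close>

text \<open>The difference of two branches is continuous with values in the discrete set of
  multiples of 2 pi i, hence constant on a connected set.\<close>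

lemma log_branch_unique:
  assumes S: "connected S" "S \<noteq> {}" and L: "log_branch S f L" and M: "log_branch S f M"
  obtains m :: int where "\<And>z. z \<in> S \<Longrightarrow> L z = M z + of_int (2 * m) * of_real pi * \<i>"
proof -
  have *: "\<exists>n::int. L z = M z + of_int (2 * n) * of_real pi * \<i>" if "z \<in> S" for z
    using that L M exp_eq[of "L z" "M z"] by (auto simp: log_branch_def)
  have "(\<lambda>z. L z - M z) constant_on S"
  proof (rule continuous_discrete_range_constant[OF S(1)])
    show "continuous_on S (\<lambda>z. L z - M z)"
      using L M by (auto simp: log_branch_def intro!: continuous_intros)
    fix z assume z: "z \<in> S"
    \<comment> \<open>Distinct multiples of 2 pi i are at least 2 pi apart, so 1 is a sufficient
      gap.\<close>
    have "1 \<le> norm (L w - M w - (L z - M z))" if "w \<in> S" "L w - M w \<noteq> L z - M z" for w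
    proof -
      obtain i j :: int where ij: "L w = M w + of_int (2 * i) * of_real pi * \<i>"
        "L z = M z + of_int (2 * j) * of_real pi * \<i>"
        using *[OF \<open>w \<in> S\<close>] *[OF z] by blast
      with that have "i \<noteq> j"
        by auto
      then have "1 \<le> \<bar>real_of_int (i - j)\<bar>"
        by linarith
      moreover have "L w - M w - (L z - M z) = of_real (2 * pi * of_int (i - j)) * \<i>"
        by (simp add: ij algebra_simps)
      then have "norm (L w - M w - (L z - M z)) = 2 * pi * \<bar>real_of_int (i - j)\<bar>"
        by (simp add: norm_mult abs_mult del: of_real_mult)
      ultimately show ?thesis
        using mult_mono[of 1 "2 * pi" 1 "\<bar>real_of_int (i - j)\<bar>"] pi_gt3 by simp
    qed
    then show "\<exists>e>0. \<forall>w. w \<in> S \<and> L w - M w \<noteq> L z - M z \<longrightarrow> e \<le> norm (L w - M w - (L z - M z))"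
      by (intro exI[of _ 1]) auto
  qed
  then obtain c where c: "\<And>z. z \<in> S \<Longrightarrow> L z - M z = c"
    by (auto simp: constant_on_def)
  obtain z0 where "z0 \<in> S"
    using S(2) by auto
  then obtain m :: int where "c = of_int (2 * m) * of_real pi * \<i>"
    using *[of z0] c[of z0] by auto
  then show ?thesis
    using c by (intro that[of m]) (metis add_diff_cancel_left' diff_add_cancel add.commute)
qed

text \<open>The value at \<open>z0\<close> can be prescribed because any holomorphic logarithm
  \<open>l\<close> may be shifted by the constant \<open>w - l z0\<close>, a period of
  \<open>exp\<close>.\<close>

lemma log_branch_exists_at:
  assumes "open D" "simply_connected D" and f: "f holomorphic_on D" "\<And>z. z \<in> D \<Longrightarrow> f z \<noteq> 0"
    and z0: "z0 \<in> D" "exp w = f z0"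
  obtains L where "log_branch D f L" "L holomorphic_on D" "L z0 = w"
proof -
  obtain l where l: "l holomorphic_on D" "\<And>z. z \<in> D \<Longrightarrow> f z = exp (l z)"
    using simply_connected_imp_holomorphic_log[OF f(1) assms(2) open_imp_locally_path_connected]
      assms(1) f(2) by blast
  define L where "L = (\<lambda>z. l z + (w - l z0))"
  have hol: "L holomorphic_on D"
    unfolding L_def by (intro holomorphic_intros l)
  have "exp (w - l z0) = 1"
    using z0 l(2)[of z0] by (simp add: exp_diff)
  then have "log_branch D f L"
    using l(2) hol by (auto simp: log_branch_def L_def exp_add holomorphic_on_imp_continuous_on)
  with hol show ?thesis
    by (intro that[of L]) (auto simp: L_def)
qed

section \<open>Summing the logarithms of the factors\<close>

text \<open>To each point of \<open>K\<close> attach a closed ball and a path from \<open>z0\<close>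
  to its centre. Finitely many of these sets cover \<open>K\<close>, and since all contain
  \<open>z0\<close> their union is connected. On such a set, branches normalised at
  \<open>z0\<close> can be compared.\<close>

lemma compact_subset_compact_connected:
  fixes D :: "'a :: euclidean_space set"
  assumes D: "open D" "connected D" "z0 \<in> D" and K: "compact K" "K \<subseteq> D"
  obtains K' where "compact K'" "connected K'" "K \<subseteq> K'" "K' \<subseteq> D" "z0 \<in> K'"
proof -
  have "\<exists>C r. compact C \<and> connected C \<and> C \<subseteq> D \<and> z0 \<in> C \<and> r > 0 \<and> ball x r \<subseteq> C" if "x \<in> K" for x
  proof -
    have x: "x \<in> D"
      using that K by auto
    obtain r where r: "r > 0" "cball x r \<subseteq> D"
      using D x open_contains_cball by blast
    have "path_connected D"
      using D by (simp add: connected_open_path_connected)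
    then obtain \<gamma> where \<gamma>: "path \<gamma>" "path_image \<gamma> \<subseteq> D" "pathstart \<gamma> = z0" "pathfinish \<gamma> = x"
      using D(3) x unfolding path_connected_def by blast
    have "x \<in> cball x r \<inter> path_image \<gamma>" "z0 \<in> path_image \<gamma>"
      using \<gamma> r by (auto simp: pathfinish_in_path_image pathstart_in_path_image
          simp flip: \<gamma>(3,4))
    then have "connected (cball x r \<union> path_image \<gamma>)"
      using connected_Un[OF connected_cball connected_path_image[OF \<gamma>(1)]] by blast
    then show ?thesis
      using \<gamma> r \<open>z0 \<in> path_image \<gamma>\<close>
      by (intro exI[of _ "cball x r \<union> path_image \<gamma>"] exI[of _ r])
        (auto simp: compact_Un compact_path_image)
  qed
  then obtain C r where C: "\<And>x. x \<in> K \<Longrightarrow> compact (C x) \<and> connected (C x) \<and> C x \<subseteq> D \<and> z0 \<in> C x"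
    and r: "\<And>x. x \<in> K \<Longrightarrow> r x > 0 \<and> ball x (r x) \<subseteq> C x"
    by metis
  obtain F where F: "F \<subseteq> K" "finite F" "K \<subseteq> (\<Union>x\<in>F. ball x (r x))"
    by (rule compactE_image[OF K(1), of K "\<lambda>x. ball x (r x)"]) (use r in auto)
  \<comment> \<open>Inserting \<open>{z0}\<close> keeps \<open>z0\<close> in \<open>K'\<close> when
    \<open>K\<close> is empty.\<close>
  define K' where "K' = \<Union>(insert {z0} (C ` F))"
  show ?thesis
  proof (rule that[of K'])
    show "compact K'"
      unfolding K'_def using F C by (intro compact_Union) auto
    show "connected K'"
      unfolding K'_def using F C by (intro connected_Union) auto
    show "K \<subseteq> K'" "K' \<subseteq> D" "z0 \<in> K'"
      using F C r D(3) unfolding K'_def by (auto, blast+)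
  qed
qed

text \<open>
  On a compact connected set containing the base point, all but finitely many of the branches
  normalised at the base point are principal logarithms, which the M-test controls.
\<close>

lemma (in weierstrass_product) uniform_limit_log_series:
  assumes D: "open D" "connected D" "z0 \<in> D"
    and e: "\<And>n. log_branch D (\<lambda>z. weierstrass_factor (p n) (z / a n)) (e n)"
    and e0: "\<And>n. e n z0 = Ln (weierstrass_factor (p n) (z0 / a n))"
    and K: "compact K" "K \<subseteq> D"
  shows "uniform_limit K (\<lambda>N z. \<Sum>n<N. e n z) (\<lambda>z. \<Sum>n. e n z) sequentially"
proof -
  obtain K' where K': "compact K'" "connected K'" "K \<subseteq> K'" "K' \<subseteq> D" "z0 \<in> K'"
    using compact_subset_compact_connected[OF D K] by blast
  obtain R where R: "R > 0" "\<And>z. z \<in> K' \<Longrightarrow> norm z \<le> R"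
    using compact_imp_bounded[OF K'(1)] by (auto simp: bounded_pos)
  define M where "M = (\<lambda>n. (R / norm (a n)) ^ Suc (p n))"
  have sumM: "summable M"
    unfolding M_def using R by (intro summable_a_p)
  \<comment> \<open>\<open>2 * R\<close> puts \<open>z / a n\<close> into the disc of radius 1/2,
    where \<open>E z - 1\<close> is bounded by \<open>3 * M n\<close>. The threshold 1/6 makes this
    less than 1/2, so \<open>E z\<close> stays in the right half-plane and \<open>norm_Ln_le\<close>
    costs a factor 2; hence 6 = 2 * 3.\<close>
  have "eventually (\<lambda>n. norm (a n) \<ge> 2 * R) sequentially"
    using filterlim_a by (metis filterlim_at_infinity_imp_norm_at_top filterlim_at_top)
  moreover have "eventually (\<lambda>n. M n < 1 / 6) sequentially"
    using order_tendstoD(2)[OF summable_LIMSEQ_zero[OF sumM], of "1 / 6"] by simp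
  ultimately have "eventually (\<lambda>n. \<forall>z\<in>K'. norm (e n z) \<le> 6 * M n) sequentially"
  proof eventually_elim
    case (elim n)
    define E where "E = (\<lambda>z. weierstrass_factor (p n) (z / a n))"
    have E: "norm (E z - 1) \<le> 3 * M n" if "z \<in> K'" for z
    proof -
      have "norm (z / a n) \<le> R / norm (a n)"
        using R(2)[OF that] by (simp add: norm_divide divide_right_mono)
      moreover have "R / norm (a n) \<le> 1 / 2"
        using elim(1) R(1) by (simp add: field_simps a_nonzero)
      ultimately have "norm (z / a n) \<le> 1 / 2"
        by (rule order_trans)
      then have "norm (E z - 1) \<le> 3 * norm (z / a n) ^ Suc (p n)"
        unfolding E_def by (rule weierstrass_factor_bound)
      also have "\<dots> \<le> 3 * M n"
        unfolding M_def using \<open>norm (z / a n) \<le> R / norm (a n)\<close>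
        by (intro mult_left_mono power_mono) auto
      finally show ?thesis .
    qed
    have small: "norm (E z - 1) < 1 / 2" if "z \<in> K'" for z
      using E[OF that] elim(2) by linarith
    have Re: "Re (E z) > 0" if "z \<in> K'" for z
      using small[OF that] abs_Re_le_cmod[of "E z - 1"] by simp
    have "continuous_on K' E"
      unfolding E_def by (intro continuous_intros) (auto simp: a_nonzero)
    then have "continuous_on K' (\<lambda>z. Ln (E z))"
      using Re by (intro continuous_intros) (auto simp: complex_nonpos_Reals_iff dest!: Re)
    moreover have "exp (Ln (E z)) = E z" if "z \<in> K'" for z
      using Re[OF that] by (intro exp_Ln) auto
    ultimately have "log_branch K' E (\<lambda>z. Ln (E z))"
      by (simp add: log_branch_def)
    moreover have "log_branch K' E (e n)"
      using e[of n] K'(4) by (auto simp: log_branch_def E_def intro: continuous_on_subset)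
    ultimately obtain m :: int
      where m: "\<And>z. z \<in> K' \<Longrightarrow> e n z = Ln (E z) + of_int (2 * m) * of_real pi * \<i>"
      using log_branch_unique[of K' E "e n" "\<lambda>z. Ln (E z)"] K'(2,5) by blast
    \<comment> \<open>Both branches take the same value at \<open>z0\<close> by the
      normalisation.\<close>
    have "m = 0"
      using m[OF K'(5)] e0[of n] by (simp add: E_def)
    show ?case
    proof
      fix z assume z: "z \<in> K'"
      have "norm (e n z) = norm (Ln (1 + (E z - 1)))"
        using m[OF z] \<open>m = 0\<close> by simp
      also have "\<dots> \<le> 2 * norm (E z - 1)"
        by (intro norm_Ln_le small z)
      also have "\<dots> \<le> 6 * M n"
        using E[OF z] by simp
      finally show "norm (e n z) \<le> 6 * M n" .
    qed
  qed
  then have "uniform_limit K' (\<lambda>N z. \<Sum>n<N. e n z) (\<lambda>z. \<Sum>n. e n z) sequentially"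
    using sumM by (intro Weierstrass_m_test_ev[where M = "\<lambda>n. 6 * M n"] summable_mult)
  then show ?thesis
    by (rule uniform_limit_on_subset) fact
qed

text \<open>Uniform convergence on closed balls inside \<open>D\<close> makes the sum continuous,
  and \<open>exp\<close> turns partial sums into partial products.\<close>

lemma (in weierstrass_product) log_branch_log_series:
  assumes D: "open D" "connected D" "z0 \<in> D"
    and e: "\<And>n. log_branch D (\<lambda>z. weierstrass_factor (p n) (z / a n)) (e n)"
    and e0: "\<And>n. e n z0 = Ln (weierstrass_factor (p n) (z0 / a n))"
  shows "log_branch D (\<lambda>z. \<Prod>n. weierstrass_factor (p n) (z / a n)) (\<lambda>z. \<Sum>n. e n z)"
  unfolding log_branch_def
proof (intro conjI ballI)
  note lim = uniform_limit_log_series[OF D e e0]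
  have cont: "continuous_on D (e n)" for n
    using e by (simp add: log_branch_def)
  have "isCont (\<lambda>z. \<Sum>n. e n z) z" if z: "z \<in> D" for z
  proof -
    obtain r where r: "r > 0" "cball z r \<subseteq> D"
      using D(1) z open_contains_cball by blast
    have "continuous_on (cball z r) (\<lambda>z. \<Sum>n. e n z)"
      using r by (intro uniform_limit_theorem[OF _ lim] always_eventually allI continuous_intros
          continuous_on_subset[OF cont]) auto
    then show ?thesis
      using r by (intro continuous_on_interior[of "cball z r"]) auto
  qed
  then show "continuous_on D (\<lambda>z. \<Sum>n. e n z)"
    by (simp add: continuous_at_imp_continuous_on)
  fix z assume z: "z \<in> D"
  have "(\<lambda>N. \<Sum>n<N. e n z) \<longlonglongrightarrow> (\<Sum>n. e n z)"
    using tendsto_uniform_limitI[OF lim[of "{z}"]] z by simp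
  \<comment> \<open>The partial sums run over n < N but the partial products over n <= N, hence the
    shift.\<close>
  then have "(\<lambda>N. exp (\<Sum>n<Suc N. e n z)) \<longlonglongrightarrow> exp (\<Sum>n. e n z)"
    by (intro tendsto_exp) (rule LIMSEQ_Suc)
  moreover have "exp (\<Sum>n<Suc N. e n z) = (\<Prod>n\<le>N. weierstrass_factor (p n) (z / a n))" for N
    unfolding lessThan_Suc_atMost using e z by (simp add: exp_sum log_branch_def)
  ultimately show "exp (\<Sum>n. e n z) = (\<Prod>n. weierstrass_factor (p n) (z / a n))"
    using convergent_prod_LIMSEQ[OF convergent[of z]] LIMSEQ_unique by simp
qed

section \<open>Assembling the decomposition\<close>

text \<open>\<open>k\<close> times a logarithm of z, plus \<open>g\<close>, plus the summed
  logarithms of the factors is a logarithm of \<open>f\<close>, so it differs from \<open>L\<close>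
  by a constant period. Each factor's logarithm splits into one of \<open>1 - z / a n\<close> and a
  polynomial.\<close>

lemma helicoid_decomposition_of_representation:
  assumes W: "weierstrass_product (\<lambda>n. a (Suc n)) (\<lambda>n. p (Suc n))"
    and rep: "weierstrass_representation f k a p g"
    and D: "open D" "connected D" "simply_connected D" "D \<noteq> {}" "0 \<notin> D"
    and aD: "\<And>n. n \<ge> 1 \<Longrightarrow> a n \<notin> D"
    and L: "log_branch D f L"
    and h: "\<And>x y. Complex x y \<in> D \<Longrightarrow> h x y = Im (L (Complex x y))"
  shows "helicoid_decomposition D h k a p g"
proof -
  interpret W: weierstrass_product "\<lambda>n. a (Suc n)" "\<lambda>n. p (Suc n)"
    by (rule W)
  have a_nz: "a n \<noteq> 0" if "n \<ge> 1" for n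
    using W.a_nonzero[of "n - 1"] that by simp
  obtain z0 where z0: "z0 \<in> D"
    using D by auto
  have "exp (Ln z0) = z0"
    using z0 D by (intro exp_Ln) auto
  then obtain l0 where l0: "log_branch D (\<lambda>z. z) l0"
    using log_branch_exists_at[OF D(1,3) holomorphic_on_ident _ z0] D(5) by metis
  define E where "E = (\<lambda>n z. weierstrass_factor (p n) (z / a n))"
  \<comment> \<open>The common normalisation by \<open>Ln\<close> at \<open>z0\<close> secures
    convergence: arbitrary branches could be off by nonzero multiples of 2 pi i for infinitely many
    \<open>n\<close>.\<close>
  have "\<exists>e. log_branch D (E n) e \<and> e z0 = Ln (E n z0)" if n: "n \<ge> 1" for n
  proof -
    have "E n holomorphic_on D"
      unfolding E_def by (intro holomorphic_intros) (use a_nz n in auto)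
    moreover have nz: "E n z \<noteq> 0" if "z \<in> D" for z
      using that aD[OF n] a_nz[OF n] by (auto simp: E_def)
    moreover have "exp (Ln (E n z0)) = E n z0"
      using nz z0 by (intro exp_Ln)
    ultimately show ?thesis
      using log_branch_exists_at[OF D(1,3), of "E n" z0 "Ln (E n z0)"] z0 by metis
  qed
  then obtain e where e: "\<And>n. n \<ge> 1 \<Longrightarrow> log_branch D (E n) (e n)"
    and e0: "\<And>n. n \<ge> 1 \<Longrightarrow> e n z0 = Ln (E n z0)"
    by metis
  define T where "T = (\<lambda>z. \<Sum>n. e (Suc n) z)"
  have lim: "uniform_limit K (\<lambda>N z. \<Sum>n<N. e (Suc n) z) T sequentially"
    if "compact K" "K \<subseteq> D" for K
    unfolding T_def using e e0 by (intro W.uniform_limit_log_series[OF D(1,2) z0 _ _ that])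
      (auto simp: E_def)
  have T: "log_branch D (\<lambda>z. \<Prod>n. E (Suc n) z) T"
    unfolding T_def E_def using e e0 by (intro W.log_branch_log_series[OF D(1,2) z0])
      (auto simp: E_def)

  have g: "g holomorphic_on UNIV"
    and f: "\<And>z. f z = z ^ k * exp (g z) * (\<Prod>n. E (Suc n) z)"
    using rep by (auto simp: weierstrass_representation_def E_def)
  have "continuous_on D g"
    using g holomorphic_on_imp_continuous_on holomorphic_on_subset by blast
  then have "log_branch D f (\<lambda>z. of_nat k * l0 z + g z + T z)"
    using l0 T by (auto simp: log_branch_def f exp_add exp_of_nat_mult intro!: continuous_intros)
  then obtain m :: int where m: "\<And>z. z \<in> D \<Longrightarrow>
      L z = of_nat k * l0 z + g z + T z + of_int (2 * m) * of_real pi * \<i>"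
    using log_branch_unique[OF D(2,4) L] by blast

  define P where "P = (\<lambda>n z. primary_exponent (p n) (z / a n))"
  have P: "P n holomorphic_on UNIV" if "n \<ge> 1" for n
    unfolding P_def by (intro holomorphic_intros) (use a_nz that in auto)
  \<comment> \<open>Removing the polynomial exponent leaves a logarithm of the linear factor. Apart
    from the constant correction, the n-th joint summand is then \<open>Im (e n z)\<close>, so the
    two parts need not be summable separately.\<close>
  define l where "l = (\<lambda>n z. e n z - P n z)"
  have l: "log_branch D (\<lambda>z. 1 - z / a n) (l n)" if n: "n \<ge> 1" for n
  proof -
    have "continuous_on D (P n)"
      using P[OF n] holomorphic_on_imp_continuous_on holomorphic_on_subset by blast
    then show ?thesis
      using e[OF n]
      by (auto simp: log_branch_def l_def exp_diff E_def P_def weierstrass_factor_primary_exponent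
          intro!: continuous_intros)
  qed
  \<comment> \<open>The ambiguity of \<open>L\<close> is absorbed into the first helicoid rather than into the first summand,
      which disappears for \<open>k = 0\<close>.\<close>
  define c :: "nat \<Rightarrow> int" where "c = (\<lambda>n. if n = 1 then 2 * m else 0)"
  define t where "t = (\<lambda>n x y. Im (l n (Complex x y)) + of_int (c n) * pi)"
  \<comment> \<open>The summand \<open>of_int 0 * pi\<close> brings \<open>t0\<close> into the form
    of \<open>arctan_branch_Im_log\<close>.\<close>
  define t0 where "t0 = (\<lambda>x y. Im (l0 (Complex x y)) + of_int 0 * pi)"
  define S where "S = (\<lambda>z. Im (T z) + of_int (2 * m) * pi)"

  have "arctan_branch D (\<lambda>x y. y) (\<lambda>x y. x) t0"
    unfolding t0_def by (rule arctan_branch_Im_log[OF l0, of 1]) auto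
  moreover have "height_graph D t0 \<subseteq> helicoid"
  proof
    fix Q assume "Q \<in> height_graph D t0"
    then obtain x y w where Q: "Q = (x, y, Im w)" and w: "exp w = Complex x y"
      using l0 by (auto simp: height_graph_def t0_def log_branch_def)
    have xy: "x = exp (Re w) * cos (Im w)" "y = exp (Re w) * sin (Im w)"
      using w by (auto simp: complex_eq_iff Re_exp Im_exp)
    show "Q \<in> helicoid"
      unfolding Q helicoid_def xy by simp
  qed
  moreover have "arctan_branch D (\<lambda>x y. Im (a n) * x - Re (a n) * y)
      (\<lambda>x y. (cmod (a n))\<^sup>2 - Re (a n) * x - Im (a n) * y) (t n)" if n: "n \<ge> 1" for n
    unfolding t_def
  proof (rule arctan_branch_Im_log[OF l[OF n], of "(cmod (a n))\<^sup>2"])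
    show "(cmod (a n))\<^sup>2 > 0"
      using a_nz[OF n] by simp
    fix x y
    \<comment> \<open>The squared modulus is \<open>a n * cnj (a n)\<close>, so the denominator
      cancels; the two linear forms are then read off from \<open>z * cnj (a n)\<close>.\<close>
    have *: "complex_of_real ((cmod (a n))\<^sup>2) * (1 - Complex x y / a n) = 
        complex_of_real ((cmod (a n))\<^sup>2) - Complex x y * cnj (a n)"
      unfolding complex_norm_square using a_nz[OF n] by (simp add: field_simps)
    show "complex_of_real ((cmod (a n))\<^sup>2) * (1 - Complex x y / a n) =
        Complex ((cmod (a n))\<^sup>2 - Re (a n) * x - Im (a n) * y) (Im (a n) * x - Re (a n) * y)"
      unfolding * by (simp add: complex_eq_iff algebra_simps)
  qed
  moreover have "\<exists>r>0. \<exists>v. height_graph D (t n) \<subseteq> dilate_translate r v ` helicoid"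
    if n: "n \<ge> 1" for n
    unfolding t_def
  proof (rule height_graph_log_subset_helicoid)
    have "(\<lambda>z. 1 - z / a n) = (\<lambda>z. (z - a n) / (- a n))"
      using a_nz[OF n] by (auto simp: field_simps)
    then show "log_branch D (\<lambda>z. (z - a n) / (- a n)) (l n)"
      using l[OF n] by simp
  qed (use a_nz[OF n] in auto)
  moreover have "let q = (\<lambda>x y. Im (P n (Complex x y)))
         in graphical_isotropic_minimal_surface (height_graph UNIV q) UNIV q" if "n \<ge> 1" for n
    unfolding Let_def by (rule minimal_surface_Im_entire[OF P[OF that]])
  moreover have "let u = (\<lambda>x y. Im (g (Complex x y)))
      in graphical_isotropic_minimal_surface (height_graph UNIV u) UNIV u"
    unfolding Let_def by (rule minimal_surface_Im_entire[OF g])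
  moreover have "uniform_limit K (\<lambda>N z. \<Sum>n=1..N. t n (Re z) (Im z) + Im (P n z)) S sequentially"
    if K: "compact K \<and> K \<subseteq> D" for K
  proof -
    have "uniform_limit K (\<lambda>N z. Im (\<Sum>n<N. e (Suc n) z)) (\<lambda>z. Im (T z)) sequentially"
      by (intro bounded_linear.uniform_limit[OF bounded_linear_Im] lim) (use K in auto)
    then have "uniform_limit K (\<lambda>N z. Im (\<Sum>n<N. e (Suc n) z) + of_int (2 * m) * pi) S sequentially"
      unfolding S_def by (intro uniform_limit_add uniform_limit_const)
    \<comment> \<open>Equality starts at N = 1: the whole correction \<open>2 * m * pi\<close> sits
      in the first term, which the empty sum lacks.\<close>
    moreover have "eventually (\<lambda>N. \<forall>z\<in>K. Im (\<Sum>n<N. e (Suc n) z) + of_int (2 * m) * pi =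
        (\<Sum>n=1..N. t n (Re z) (Im z) + Im (P n z))) sequentially"
      using eventually_ge_at_top[of 1]
    proof eventually_elim
      case (elim N)
      have "(\<Sum>n=1..N. of_int (c n) * pi) = of_int (2 * m) * pi"
        using elim by (simp add: c_def if_distrib if_distribR sum.delta cong: if_cong)
      moreover have "(\<Sum>n=1..N. t n (Re z) (Im z) + Im (P n z)) =
          (\<Sum>n=1..N. Im (e n z)) + (\<Sum>n=1..N. of_int (c n) * pi)" for z
        unfolding sum.distrib[symmetric] by (simp add: t_def l_def)
      moreover have "(\<Sum>n=1..N. Im (e n z)) = Im (\<Sum>n<N. e (Suc n) z)" for z
        by (simp add: sum.atLeast1_atMost_eq)
      ultimately show ?case
        by simp
    qed
    ultimately show ?thesis
      by (subst (asm) uniform_limit_cong) auto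
  qed
  moreover have "h x y = real k * t0 x y + S (Complex x y) + Im (g (Complex x y))"
    if "Complex x y \<in> D" for x y
    using h[OF that] m[OF that] by (simp add: t0_def S_def)
  ultimately show ?thesis
    unfolding helicoid_decomposition_def P_def by blast
qed

section \<open>Weierstrass products with prescribed zeros\<close>

text \<open>A closed disc contains finitely many zeros of \<open>f\<close>, each listed finitely
  often, so only finitely many terms of the sequence lie in it.\<close>

lemma filterlim_zeros_at_infinity:
  assumes f: "f holomorphic_on UNIV" "\<exists>z. f z \<noteq> 0"
    and a: "\<And>n. f (a n) = 0" "\<And>z. finite {n. a n = z}"
  shows "filterlim a at_infinity sequentially"
  unfolding filterlim_at_infinity_conv_norm_at_top filterlim_at_top
proof
  fix R
  have "\<not> f constant_on UNIV"
    using f(2) a(1) by (auto simp: constant_on_def) metis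
  then have "finite {z \<in> cball 0 R. f z = 0}"
    by (intro holomorphic_compact_finite_zeros[OF f(1)]) auto
  then have "finite (\<Union>z\<in>{z \<in> cball 0 R. f z = 0}. {n. a n = z})"
    using a(2) by blast
  then have "finite {n. \<not> R \<le> norm (a n)}"
    by (rule rev_finite_subset) (use a(1) in auto)
  then show "eventually (\<lambda>n. R \<le> norm (a n)) sequentially"
    by (simp add: eventually_cofinite cofinite_eq_sequentially[symmetric])
qed

lemma card_Suc_vimage: "card {n. n \<ge> 1 \<and> a n = z} = card {n. a (Suc n) = z}"
proof -
  have "{n. n \<ge> 1 \<and> a n = z} = Suc ` {n. a (Suc n) = z}"
    by (auto simp: image_iff) (metis Suc_le_D)
  then show ?thesis
    by (simp add: card_image)
qed

text \<open>Once \<open>norm (a n)\<close> exceeds 2r, degrees at least \<open>n\<close> give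
  domination by a geometric series with ratio 1/2. Stating this for all \<open>p n \<ge> n\<close>
  also covers the second representation used for non-uniqueness.\<close>

lemma weierstrass_product_of_zeros:
  assumes a_nz: "\<And>n. n \<ge> 1 \<Longrightarrow> a n \<noteq> 0"
    and f: "f holomorphic_on UNIV" "\<exists>z. f z \<noteq> 0"
    and zeros: "lists_nonzero_zeros a f"
    and p: "\<And>n. n \<ge> 1 \<Longrightarrow> p n \<ge> n"
  shows "weierstrass_product (\<lambda>n. a (Suc n)) (\<lambda>n. p (Suc n))"
proof -
  obtain z1 where "f z1 \<noteq> 0"
    using f(2) by blast
  then have "eventually (\<lambda>w. f w \<noteq> 0 \<and> w \<in> UNIV) (at z)" for z
    using f(1) by (intro non_zero_neighbour_alt) auto
  then have freq: "frequently (\<lambda>w. f w \<noteq> 0) (at z)" for z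
    by (intro eventually_frequently) auto
  \<comment> \<open>\<open>lists_nonzero_zeros\<close> is silent at 0, where the fibre is empty
    because no listed value vanishes.\<close>
  have fin: "finite {n. a (Suc n) = z}" for z
  proof (cases "z = 0")
    case True
    then have "{n. a (Suc n) = z} = {}"
      using a_nz by auto
    then show ?thesis
      by simp
  next
    case False
    have "Suc ` {n. a (Suc n) = z} \<subseteq> {n. n \<ge> 1 \<and> a n = z}"
      by auto
    moreover have "finite {n. n \<ge> 1 \<and> a n = z}"
      using zeros False by (simp add: lists_nonzero_zeros_def)
    ultimately have "finite (Suc ` {n. a (Suc n) = z})"
      by (rule finite_subset)
    then show ?thesis
      by (rule finite_imageD) simp
  qed
  have zero: "f (a (Suc n)) = 0" for n
  proof -
    \<comment> \<open>The index \<open>n\<close> itself is counted, so the order is positive and the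
      point is a zero.\<close>
    have "zorder f (a (Suc n)) = int (card {m. a (Suc m) = a (Suc n)})"
      using zeros a_nz[of "Suc n"] by (simp add: lists_nonzero_zeros_def flip: card_Suc_vimage[of a])
    also have "\<dots> > 0"
      using fin by (auto simp: card_gt_0_iff)
    finally show ?thesis
      using zorder_pos_iff[OF f(1) open_UNIV UNIV_I freq] by blast
  qed
  have lim: "filterlim (\<lambda>n. a (Suc n)) at_infinity sequentially"
    by (rule filterlim_zeros_at_infinity[OF f zero fin])
  show ?thesis
  proof
    show "summable (\<lambda>n. (r / norm (a (Suc n))) ^ Suc (p (Suc n)))" if r: "r > 0" for r
    proof (rule summable_comparison_test_ev)
      have "eventually (\<lambda>n. norm (a (Suc n)) > 2 * r) sequentially"
        using lim by (metis filterlim_at_infinity_imp_norm_at_top filterlim_at_top_dense)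
      then show "eventually (\<lambda>n. norm ((r / norm (a (Suc n))) ^ Suc (p (Suc n))) \<le> (1 / 2) ^ n)
          sequentially"
      proof eventually_elim
        case (elim n)
        have *: "0 \<le> r / norm (a (Suc n))" "r / norm (a (Suc n)) \<le> 1 / 2"
          using r elim a_nz[of "Suc n"] by (auto simp: divide_simps)
        have "norm ((r / norm (a (Suc n))) ^ Suc (p (Suc n))) = (r / norm (a (Suc n))) ^ Suc (p (Suc n))"
          using r by (simp add: abs_mult power_abs)
        also have "\<dots> \<le> (1 / 2) ^ Suc (p (Suc n))"
          using * by (intro power_mono)
        also have "\<dots> \<le> (1 / 2) ^ n"
          using p[of "Suc n"] by (intro power_decreasing) auto
        finally show ?case .
      qed
    qed (auto intro!: summable_geometric)
  qed (use lim a_nz in auto)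
qed

text \<open>\<open>z ^ k\<close> times the product has the same order as \<open>f\<close> at every
  point, so \<open>f\<close> is this function times a zero-free entire one, which has an entire
  logarithm because the plane is contractible.\<close>

lemma weierstrass_representation_exists:
  assumes W: "weierstrass_product (\<lambda>n. a (Suc n)) (\<lambda>n. p (Suc n))"
    and f: "f holomorphic_on UNIV" "\<exists>z. f z \<noteq> 0"
    and zeros: "lists_nonzero_zeros a f" "zorder f 0 = int k"
  shows "\<exists>g. weierstrass_representation f k a p g"
proof -
  interpret W: weierstrass_product "\<lambda>n. a (Suc n)" "\<lambda>n. p (Suc n)"
    by (rule W)
  define F where "F = (\<lambda>z. z ^ k * W.f z)"
  have hol: "F holomorphic_on UNIV"
    unfolding F_def by (intro holomorphic_intros W.holomorphic)
  obtain z1 where "f z1 \<noteq> 0"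
    using f(2) by blast
  then have "eventually (\<lambda>w. f w \<noteq> 0 \<and> w \<in> UNIV) (at z)" for z
    using f(1) by (intro non_zero_neighbour_alt) auto
  then have f_freq: "frequently (\<lambda>w. f w \<noteq> 0) (at z)" for z
    by (intro eventually_frequently) auto
  have W_ev: "eventually (\<lambda>w. W.f w \<noteq> 0) (at z)" for z
    using W.not_islimpt_range_a[of z] by (simp add: islimpt_iff_eventually W.zero)
  have F_ev: "eventually (\<lambda>w. F w \<noteq> 0) (at z)" for z
    using W_ev[of z] eventually_neq_at_within[of 0 z UNIV]
    by eventually_elim (auto simp: F_def)
  have W0: "W.f 0 \<noteq> 0"
    using W.a_nonzero by (auto simp: W.zero image_iff)
  \<comment> \<open>At 0 the order comes from \<open>z ^ k\<close> alone, the product being nonzero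
    there; elsewhere the power contributes nothing and the product counts the listed
    multiplicity.\<close>
  have ord: "zorder F z = zorder f z" for z
  proof (cases "z = 0")
    case True
    have "zorder F 0 = int k"
      by (rule zorder_eqI[of UNIV _ W.f]) (auto simp: F_def W0 intro: W.holomorphic)
    then show ?thesis
      using True zeros(2) by simp
  next
    case False
    have "zorder F z = zorder (\<lambda>w. w ^ k) z + zorder W.f z"
      unfolding F_def using F_ev[of z]
      by (intro zorder_times_analytic analytic_intros W.analytic) (simp add: F_def)
    also have "zorder (\<lambda>w. w ^ k) z = 0"
      using False by (intro zorder_eq_0I analytic_intros) auto
    also have "zorder W.f z = zorder f z"
      using zeros(1) False
      by (simp add: W.zorder lists_nonzero_zeros_def vimage_def flip: card_Suc_vimage[of a])
    finally show ?thesis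
      by simp
  qed
  have zero_iff: "F z = 0 \<longleftrightarrow> f z = 0" for z
    using zorder_pos_iff[OF f(1) open_UNIV UNIV_I f_freq, of z] ord[of z]
      zorder_pos_iff[OF hol open_UNIV UNIV_I eventually_frequently[OF _ F_ev], of z] by simp
  obtain H where H: "H holomorphic_on UNIV" "\<And>z. z \<in> UNIV \<Longrightarrow> H z \<noteq> 0"
    "\<And>z. z \<in> UNIV \<Longrightarrow> f z = H z * F z"
    by (rule holomorphic_zorder_factorization[OF f(1) open_UNIV connected_UNIV hol zero_iff ord], rule that)
      auto
  obtain g where g: "g holomorphic_on UNIV" "\<And>z. z \<in> UNIV \<Longrightarrow> H z = exp (g z)"
    by (rule contractible_imp_holomorphic_log[OF H(1) contractible_UNIV H(2)], assumption,
        rule that) auto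
  have "weierstrass_representation f k a p g"
    unfolding weierstrass_representation_def using g(1) W.convergent
    by (auto simp: H(3) g(2) F_def W.f_def)
  then show ?thesis
    by blast
qed

section \<open>Non-uniqueness\<close>

text \<open>One more degree in the first factor multiplies it by the exponential of the added
  monomial, and subtracting that monomial from \<open>g\<close> compensates.\<close>

lemma weierstrass_representation_change_degree:
  assumes rep: "weierstrass_representation f k a p g"
    and W: "weierstrass_product (\<lambda>n. a (Suc n)) (\<lambda>n. (p(1 := Suc (p 1))) (Suc n))"
  shows "weierstrass_representation f k a (p(1 := Suc (p 1)))
    (\<lambda>z. g z - (z / a 1) ^ Suc (p 1) / of_nat (Suc (p 1)))"
proof -
  define q where "q = p(1 := Suc (p 1))"
  define d where "d = (\<lambda>z. (z / a 1) ^ Suc (p 1) / of_nat (Suc (p 1)))"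
  interpret W: weierstrass_product "\<lambda>n. a (Suc n)" "\<lambda>n. q (Suc n)"
    using W by (simp add: q_def)
  have g: "g holomorphic_on UNIV"
    and conv: "\<And>z. convergent_prod (\<lambda>n. weierstrass_factor (p (Suc n)) (z / a (Suc n)))"
    and f: "\<And>z. f z = z ^ k * exp (g z) * (\<Prod>n. weierstrass_factor (p (Suc n)) (z / a (Suc n)))"
    using rep by (auto simp: weierstrass_representation_def)
  have "(\<Prod>n. weierstrass_factor (q (Suc n)) (z / a (Suc n))) =
      exp (d z) * (\<Prod>n. weierstrass_factor (p (Suc n)) (z / a (Suc n)))" for z
  proof (rule LIMSEQ_unique)
    \<comment> \<open>Only the degree at \<open>Suc 0\<close> changes, so the extra exponential
      enters at N = 0 and the induction step merely carries it along.\<close>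
    have "(\<Prod>n\<le>N. weierstrass_factor (q (Suc n)) (z / a (Suc n))) =
        exp (d z) * (\<Prod>n\<le>N. weierstrass_factor (p (Suc n)) (z / a (Suc n)))" for N
    proof (induction N)
      case 0
      show ?case
        by (simp add: q_def d_def weierstrass_factor_def exp_add del: of_nat_Suc power_Suc)
    qed (simp add: q_def)
    then show "(\<lambda>N. \<Prod>n\<le>N. weierstrass_factor (q (Suc n)) (z / a (Suc n))) \<longlonglongrightarrow>
        exp (d z) * (\<Prod>n. weierstrass_factor (p (Suc n)) (z / a (Suc n)))"
      using convergent_prod_LIMSEQ[OF conv] by (simp add: tendsto_mult_left)
  qed (rule convergent_prod_LIMSEQ[OF W.convergent])
  moreover have "a 1 \<noteq> 0"
    using W.a_nonzero[of 0] by simp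
  then have "(\<lambda>z. g z - d z) holomorphic_on UNIV"
    unfolding d_def by (intro holomorphic_intros g) (auto simp del: of_nat_Suc)
  ultimately have "weierstrass_representation f k a q (\<lambda>z. g z - d z)"
    unfolding weierstrass_representation_def using W.convergent
    by (auto simp: f exp_diff)
  then show ?thesis
    by (simp add: q_def d_def)
qed

theorem theorem3p2:
  fixes a :: "nat \<Rightarrow> complex" and f :: "complex \<Rightarrow> complex" and k :: nat
    and D :: "complex set" and X :: "(real \<times> real \<times> real) set"
    and h :: "real \<Rightarrow> real \<Rightarrow> real" and L :: "complex \<Rightarrow> complex"
  assumes "\<And>n. n \<ge> 1 \<Longrightarrow> a n \<noteq> 0"
    and "f holomorphic_on UNIV" and "\<exists>z. f z \<noteq> 0"
    and "lists_nonzero_zeros a f"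
    and "zorder f 0 = int k"
    and "open D" and "connected D" and "simply_connected D" and "D \<noteq> {}"
    and "0 \<notin> D" and "\<And>n. n \<ge> 1 \<Longrightarrow> a n \<notin> D"
    and "graphical_isotropic_minimal_surface X D h"
    and "log_branch D f L"
    and "\<And>x y. Complex x y \<in> D \<Longrightarrow> h x y = Im (L (Complex x y))"
  shows "(\<exists>g. weierstrass_representation f k a (\<lambda>n. n) g) \<and>
    (\<forall>g. weierstrass_representation f k a (\<lambda>n. n) g \<longrightarrow>
       helicoid_decomposition D h k a (\<lambda>n. n) g \<and>
       (\<exists>p g'. weierstrass_representation f k a p g' \<and>
               helicoid_decomposition D h k a p g' \<and>
               \<not> (\<lambda>z. Im (g' z) - Im (g z)) constant_on D))"
proof (intro conjI allI impI)
  have W: "weierstrass_product (\<lambda>n. a (Suc n)) (\<lambda>n. p (Suc n))" if "\<And>n. p n \<ge> n" for p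
    by (rule weierstrass_product_of_zeros[OF _ assms(2-4)]) (use assms(1) that in auto)
  show "\<exists>g. weierstrass_representation f k a (\<lambda>n. n) g"
    by (rule weierstrass_representation_exists[OF W[of "\<lambda>n. n", OF order_refl] assms(2-5)])
  fix g assume rep: "weierstrass_representation f k a (\<lambda>n. n) g"
  have dec: "helicoid_decomposition D h k a p g"
    if "\<And>n. p n \<ge> n" "weierstrass_representation f k a p g" for p g
    by (rule helicoid_decomposition_of_representation[OF W[OF that(1)] that(2) assms(6-10) _ assms(13)])
      (use assms(11,14) in auto)
  show "helicoid_decomposition D h k a (\<lambda>n. n) g"
    by (rule dec[OF order_refl rep])
  define p where "p = (\<lambda>n::nat. n)(1 := Suc 1)"
  define q where "q = (\<lambda>z. - ((z / a 1) ^ 2 / 2))"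
  have p: "p n \<ge> n" for n
    by (simp add: p_def)
  have rep': "weierstrass_representation f k a p (\<lambda>z. g z + q z)"
    using weierstrass_representation_change_degree[OF rep, folded p_def] W[OF p]
    by (simp add: q_def power2_eq_square)
  obtain z where z: "z \<in> D"
    using assms(9) by blast
  have a1: "a 1 \<noteq> 0"
    using assms(1) by simp
  \<comment> \<open>This derivative vanishes only at 0, which lies outside \<open>D\<close>; hence
    \<open>Im (q z)\<close> cannot be constant on \<open>D\<close>.\<close>
  have "(q has_field_derivative - (z / (a 1)\<^sup>2)) (at z)"
    unfolding q_def using a1 by (auto intro!: derivative_eq_intros simp: power2_eq_square field_simps)
  then have "deriv q z \<noteq> 0"
    using z a1 assms(10) by (auto simp: DERIV_imp_deriv)
  moreover have "q holomorphic_on UNIV"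
    unfolding q_def by (intro holomorphic_intros) (use a1 in auto)
  ultimately have "\<not> (\<lambda>z. Im (q z)) constant_on D"
    using Im_constant_on_imp_deriv_eq_0[OF _ assms(6) z] by blast
  then have "\<not> (\<lambda>z. Im (g z + q z) - Im (g z)) constant_on D"
    by simp
  with dec[OF p rep'] rep' show "\<exists>p g'. weierstrass_representation f k a p g' \<and>
      helicoid_decomposition D h k a p g' \<and> \<not> (\<lambda>z. Im (g' z) - Im (g z)) constant_on D"
    by blast
qed

end
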